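(* Let $q$ be a prime power and let $0<p\le 1$ satisfy $p>\frac{1}{\sqrt{2q}}$. Then $$\omega(\mathrm{CHSH}_q(p))\le p+\frac{1}{2pq}.$$
   Context: Let $\mathbb{F}_q$ be the finite field with $q$ elements. $\mathrm{CHSH}_q(p)$ is the family of two-player games, one for each probability distribution $r$ on $\mathbb{F}_q$ with $\max_{x\in\mathbb{F}_q} r(x)\le p$: Alice receives $x\in\mathbb{F}_q$ drawn according to $r$, Bob receives $y\in\mathbb{F}_q$ drawn uniformly and independently of $x$; without communicating they output $a,b\in\mathbb{F}_q$ respectively, and win iff $a+b=xy$ in $\mathbb{F}_q$. Only deterministic classical strategies are considered, i.e. pairs of functions $a,b:\mathbb{F}_q\to\mathbb{F}_q$ (Alice answers $a(x)$, Bob answers $b(y)$). For such a strategy the winning probability is $$\omega(q,p,r,a,b)=\sum_{x,y\in\mathbb{F}_q}\frac1q\, r(x)\,V(a,b,x,y),$$ where $V(a,b,x,y)=1$ if $a(x)+b(y)=xy$ and $0$ otherwise. The classical value of the family is $$\omega(\mathrm{CHSH}_q(p))=\max_{r}\max_{a,b}\ \omega(q,p,r,a,b),$$ the maximum being over all probability distributions $r$ on $\mathbb{F}_q$ with $\max_x r(x)\le p$ and all functions $a,b:\mathbb{F}_q\to\mathbb{F}_q$. *)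

theory Defs
  imports "HOL-Probability.Probability" "HOL-Number_Theory.Prime_Powers"
begin

definition chsh_win :: "('a::{finite,field} \<Rightarrow> 'a) \<Rightarrow> ('a \<Rightarrow> 'a) \<Rightarrow> 'a \<Rightarrow> 'a \<Rightarrow> real" where
  "chsh_win a b x y = (if a x + b y = x * y then 1 else 0)"

definition chsh_win_prob ::
  "'a::{finite,field} pmf \<Rightarrow> ('a \<Rightarrow> 'a) \<Rightarrow> ('a \<Rightarrow> 'a) \<Rightarrow> real" where
  "chsh_win_prob r a b =
     (\<Sum>x\<in>UNIV. \<Sum>y\<in>UNIV. 1 / real CARD('a) * pmf r x * chsh_win a b x y)"

definition chsh_dists :: "real \<Rightarrow> 'a::{finite,field} pmf set" where
  "chsh_dists p = {r. (MAX x. pmf r x) \<le> p}"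

(* The field F_q enters only through its type.  Real Sup is unspecified on the
   empty set; chsh_dists_nonempty rules this out for p \<ge> 1/q, and
   chsh_value_attained shows that the supremum is a maximum. *)
definition chsh_value :: "'a::{finite,field} itself \<Rightarrow> real \<Rightarrow> real" where
  "chsh_value _ p =
     (SUP r\<in>(chsh_dists p :: 'a pmf set). MAX (a, b). chsh_win_prob r a b)"

lemma chsh_dists_iff: "r \<in> chsh_dists p \<longleftrightarrow> (\<forall>x. pmf r x \<le> p)"
  by (auto simp: chsh_dists_def)

lemma chsh_dists_nonempty:
  assumes "p \<ge> 1 / real CARD('a::{finite,field})"
  shows "(chsh_dists p :: 'a pmf set) \<noteq> {}"
proof -
  have "(pmf_of_set UNIV :: 'a pmf) \<in> chsh_dists p"
    using assms by (simp add: chsh_dists_iff)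
  thus ?thesis by blast
qed

lemma chsh_dists_compact:
  "compact ((\<lambda>r. \<chi> x. pmf r x) ` (chsh_dists p :: 'a::{finite,field} pmf set))"
proof -
  let ?C = "{v :: (real, 'a) vec. (\<forall>x. 0 \<le> v $ x) \<and> (\<forall>x. v $ x \<le> p) \<and> (\<Sum>x\<in>UNIV. v $ x) = 1}"
  have "(\<lambda>r. \<chi> x. pmf r x) ` (chsh_dists p :: 'a pmf set) = ?C"
  proof (intro equalityI subsetI)
    fix v assume v: "v \<in> ?C"
    have "(\<integral>\<^sup>+x. ennreal (v $ x) \<partial>count_space UNIV) = 1"
      using v by (simp add: nn_integral_count_space_finite sum_ennreal)
    hence "pmf (embed_pmf (($) v)) x = v $ x" for x
      using v by (intro pmf_embed_pmf) auto
    with v show "v \<in> (\<lambda>r. \<chi> x. pmf r x) ` (chsh_dists p :: 'a pmf set)"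
      by (intro image_eqI[of _ _ "embed_pmf (($) v)"]) (auto simp: chsh_dists_iff vec_eq_iff)
  qed (auto simp: chsh_dists_iff sum_pmf_eq_1)
  moreover have "compact ?C"
  proof -
    have "closed ?C"
      by (intro closed_Collect_conj closed_Collect_all closed_Collect_le closed_Collect_eq
            continuous_intros)
    moreover have "?C \<subseteq> cbox 0 (\<chi> x. p)"
      by (auto simp: mem_box_cart)
    ultimately show ?thesis
      using bounded_subset[OF bounded_cbox] compact_eq_bounded_closed by blast
  qed
  ultimately show ?thesis by simp
qed

lemma chsh_value_attained:
  assumes "p \<ge> 1 / real CARD('a::{finite,field})"
  shows "\<exists>(r :: 'a pmf) a b. r \<in> chsh_dists p
    \<and> chsh_win_prob r a b = chsh_value TYPE('a) p
    \<and> (\<forall>(r' :: 'a pmf) a' b'. r' \<in> chsh_dists p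
          \<longrightarrow> chsh_win_prob r' a' b' \<le> chsh_value TYPE('a) p)"
proof -
  define M :: "'a pmf \<Rightarrow> real" where "M r = (MAX (a, b). chsh_win_prob r a b)" for r
  define K where "K = (\<lambda>r. \<chi> x. pmf r x) ` (chsh_dists p :: 'a pmf set)"
  define f :: "('a \<Rightarrow> 'a) \<times> ('a \<Rightarrow> 'a) \<Rightarrow> (real, 'a) vec \<Rightarrow> real" where
    "f s v = (\<Sum>x\<in>UNIV. \<Sum>y\<in>UNIV. 1 / real CARD('a) * v $ x * chsh_win (fst s) (snd s) x y)"
    for s v
  have f: "f s (\<chi> x. pmf r x) = chsh_win_prob r (fst s) (snd s)" for s r
    by (simp add: f_def chsh_win_prob_def)
  have M_ge: "chsh_win_prob r a b \<le> M r" for r a b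
    unfolding M_def by (intro Max_ge) (auto intro!: rev_image_eqI[of "(a, b)"])
  have "M r \<in> range (\<lambda>(a, b). chsh_win_prob r a b)" for r
    unfolding M_def by (intro Max_in) auto
  hence M_eq: "\<exists>a b. M r = chsh_win_prob r a b" for r by force
  have "compact K" using chsh_dists_compact K_def by simp
  moreover have "K \<noteq> {}" using chsh_dists_nonempty[OF assms] K_def by simp
  moreover have "continuous_on K (f s)" for s
    unfolding f_def by (intro continuous_intros)
  ultimately have "\<exists>v\<in>K. \<forall>w\<in>K. f s w \<le> f s v" for s
    by (rule continuous_attains_sup)
  then obtain v where v: "\<And>s. v s \<in> K" "\<And>s w. w \<in> K \<Longrightarrow> f s w \<le> f s (v s)"
    by metis
  have "Max (range (\<lambda>s. f s (v s))) \<in> range (\<lambda>s. f s (v s))"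
    by (intro Max_in) auto
  then obtain s where s: "\<And>t. f t (v t) \<le> f s (v s)"
    by (metis (mono_tags, lifting) Max_ge finite finite_imageI imageE rangeI)
  obtain r where r: "r \<in> chsh_dists p" "v s = (\<chi> x. pmf r x)"
    using v(1)[of s] by (auto simp: K_def)
  have best: "chsh_win_prob r' a' b' \<le> chsh_win_prob r (fst s) (snd s)"
    if "r' \<in> chsh_dists p" for r' :: "'a pmf" and a' b'
  proof -
    have "chsh_win_prob r' a' b' = f (a', b') (\<chi> x. pmf r' x)" by (simp add: f)
    also have "\<dots> \<le> f (a', b') (v (a', b'))" using that by (intro v(2)) (auto simp: K_def)
    also have "\<dots> \<le> f s (v s)" by (rule s)
    finally show ?thesis by (simp add: r f)
  qed
  have "Sup (M ` chsh_dists p) = chsh_win_prob r (fst s) (snd s)"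
  proof (rule cSup_eq_maximum)
    have "M r = chsh_win_prob r (fst s) (snd s)"
      using M_eq best[OF r(1)] M_ge by (metis antisym)
    thus "chsh_win_prob r (fst s) (snd s) \<in> M ` chsh_dists p" using r(1) by (metis imageI)
  next
    fix z assume "z \<in> M ` chsh_dists p"
    thus "z \<le> chsh_win_prob r (fst s) (snd s)" using M_eq best by (metis imageE)
  qed
  hence "chsh_value TYPE('a) p = chsh_win_prob r (fst s) (snd s)"
    by (simp add: chsh_value_def M_def[abs_def])
  with r(1) best show ?thesis by metis
qed

end

(* Writing S y for the set of x on which the strategy wins against y, the winning probability is
   the average over y of r (S y).  Two distinct points of the graph of Alice's answer function
   determine the slope y, so every pair of distinct x, x' lies in at most one S y.  A second-order
   Bonferroni-type inequality for weights bounded by p gives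
   r (S y) \<le> p + (1 / (2 * p)) * (sum of r x * r x' over x \<noteq> x' in S y);
   summing over y, the pair terms contribute at most 1 / (2 * p) altogether. *)
theory Submission
  imports Defs
begin

text \<open>This is the Bonferroni-type inequality with denominators cleared: the square of the sum
  minus the sum of squares is the sum over ordered pairs of distinct elements. The proof adds one
  element at a time.\<close>

lemma sum_le_bound_plus_pairs:
  fixes t :: "'a \<Rightarrow> real"
  assumes "finite S" and "\<And>x. x \<in> S \<Longrightarrow> 0 \<le> t x" and "\<And>x. x \<in> S \<Longrightarrow> t x \<le> p" and "0 \<le> p"
  shows "2 * p * sum t S + (\<Sum>x\<in>S. (t x)\<^sup>2) \<le> 2 * p\<^sup>2 + (sum t S)\<^sup>2"
  using assms(1-3)
proof (induction S rule: finite_induct)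
  case empty
  show ?case by simp
next
  case (insert x S)
  let ?s = "sum t S" and ?Q = "\<Sum>x\<in>S. (t x)\<^sup>2"
  have IH: "2 * p * ?s + ?Q \<le> 2 * p\<^sup>2 + ?s\<^sup>2" using insert by simp
  have t: "0 \<le> t x" "t x \<le> p" using insert by auto
  have s: "0 \<le> ?s" using insert by (intro sum_nonneg) auto
  have Q: "?Q \<le> ?s\<^sup>2"
  proof -
    have "?Q \<le> (\<Sum>x\<in>S. t x * ?s)"
      unfolding power2_eq_square using insert
      by (intro sum_mono mult_left_mono member_le_sum) auto
    thus ?thesis by (simp add: power2_eq_square sum_distrib_right)
  qed
  have "2 * p * (t x + ?s) + ((t x)\<^sup>2 + ?Q) \<le> 2 * p\<^sup>2 + (t x + ?s)\<^sup>2"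
  \<comment> \<open>The new element raises the right side minus the left side by
    \<open>2 * t x * (?s - p)\<close>, so the induction hypothesis suffices exactly when this is
    nonnegative for every admissible \<open>t x\<close>.\<close>
  proof (cases "p \<le> ?s")
    case True
    hence "p * t x \<le> ?s * t x" using t by (intro mult_right_mono)
    with IH show ?thesis by (simp add: power2_eq_square algebra_simps)
  next
    case False
    \<comment> \<open>Here the inequality is direct: once \<open>?Q\<close> is replaced by the
      larger \<open>?s\<^sup>2\<close>, right minus left equals twice this product.\<close>
    hence "0 \<le> (p - ?s) * (p - t x)" using t by (intro mult_nonneg_nonneg) auto
    with Q show ?thesis by (simp add: power2_eq_square algebra_simps)
  qed
  with insert show ?case by simp
qed

lemma sum_distinct_pairs:
  fixes t :: "'a \<Rightarrow> 'b::comm_ring_1"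
  assumes "finite S"
  shows "(\<Sum>(x, x')\<in>{(x, x') \<in> S \<times> S. x \<noteq> x'}. t x * t x') = (sum t S)\<^sup>2 - (\<Sum>x\<in>S. (t x)\<^sup>2)"
proof -
  have "{(x, x') \<in> S \<times> S. x \<noteq> x'} = S \<times> S - (\<lambda>x. (x, x)) ` S" by auto
  hence "(\<Sum>(x, x')\<in>{(x, x') \<in> S \<times> S. x \<noteq> x'}. t x * t x')
      = (\<Sum>(x, x')\<in>S \<times> S. t x * t x') - (\<Sum>(x, x')\<in>(\<lambda>x. (x, x)) ` S. t x * t x')"
    using assms by (simp only:) (intro sum_diff; auto)
  also have "(\<Sum>(x, x')\<in>S \<times> S. t x * t x') = (sum t S)\<^sup>2"
    by (simp add: power2_eq_square sum_product sum.cartesian_product)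
  also have "(\<Sum>(x, x')\<in>(\<lambda>x. (x, x)) ` S. t x * t x') = (\<Sum>x\<in>S. (t x)\<^sup>2)"
    by (subst sum.reindex) (auto simp: inj_on_def power2_eq_square)
  finally show ?thesis .
qed

text \<open>Subtracting the two winning conditions for one question of Bob cancels his answer. What
  remains is \<open>(x - x') * y = a x - a x'\<close>, whose right side does not depend on
  \<open>y\<close>.\<close>

lemma chsh_win_slope_unique:
  fixes a b :: "'a::field \<Rightarrow> 'a"
  assumes "a x + b y = x * y" "a x' + b y = x' * y"
    and "a x + b z = x * z" "a x' + b z = x' * z" and "x \<noteq> x'"
  shows "y = z"
proof -
  have "(x - x') * y = a x - a x'" "(x - x') * z = a x - a x'"
    unfolding left_diff_distrib assms(1-4)[symmetric] by simp_all
  with \<open>x \<noteq> x'\<close> show ?thesis by (metis mult_left_cancel right_minus_eq)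
qed

lemma chsh_win_prob_le:
  fixes r :: "'a::{finite,field} pmf"
  assumes "r \<in> chsh_dists p" and "0 < p"
  shows "chsh_win_prob r a b \<le> p + 1 / (2 * p * real CARD('a))"
proof -
  define S where "S y = {x. a x + b y = x * y}" for y
  define D where "D y = {(x, x') \<in> S y \<times> S y. x \<noteq> x'}" for y
  let ?g = "\<lambda>(x, x'). pmf r x * pmf r x'"
  have bound: "2 * p * sum (pmf r) (S y) \<le> 2 * p\<^sup>2 + sum ?g (D y)" for y
    using sum_le_bound_plus_pairs[of "S y" "pmf r" p] sum_distinct_pairs[of "S y" "pmf r"] assms
    by (simp add: chsh_dists_iff D_def)
  \<comment> \<open>Disjointness merges the pair sums for all \<open>y\<close> into one sum over a
    subset of all pairs, and the sum over all pairs is the squared total mass of \<open>r\<close>,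
    that is 1.\<close>
  have "D y \<inter> D z = {}" if "y \<noteq> z" for y z
    using that chsh_win_slope_unique[of a _ b y _ z] by (auto simp: D_def S_def)
  hence "(\<Sum>y\<in>UNIV. sum ?g (D y)) = sum ?g (\<Union>y. D y)"
    by (subst sum.UNION_disjoint) auto
  also have "\<dots> \<le> sum ?g (UNIV \<times> UNIV)"
    by (intro sum_mono2) auto
  also have "\<dots> = sum (pmf r) UNIV * sum (pmf r) UNIV"
    by (simp only: sum_product sum.cartesian_product)
  also have "\<dots> = 1" by (simp add: sum_pmf_eq_1)
  finally have pairs: "(\<Sum>y\<in>UNIV. sum ?g (D y)) \<le> 1" .
  have "2 * p * (\<Sum>y\<in>UNIV. sum (pmf r) (S y)) \<le> (\<Sum>y\<in>UNIV. 2 * p\<^sup>2 + sum ?g (D y))"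
    unfolding sum_distrib_left using bound by (intro sum_mono) (simp add: sum_distrib_left)
  also have "\<dots> \<le> 2 * p\<^sup>2 * real CARD('a) + 1"
    using pairs by (simp add: sum.distrib)
  finally have total: "2 * p * (\<Sum>y\<in>UNIV. sum (pmf r) (S y)) \<le> 2 * p\<^sup>2 * real CARD('a) + 1" .
  have "chsh_win_prob r a b
      = (\<Sum>y\<in>UNIV. \<Sum>x\<in>UNIV. 1 / real CARD('a) * pmf r x * chsh_win a b x y)"
    unfolding chsh_win_prob_def by (rule sum.swap)
  also have "\<dots> = (\<Sum>y\<in>UNIV. sum (pmf r) (S y)) / real CARD('a)"
    unfolding sum_divide_distrib
    by (intro sum.cong refl sum.mono_neutral_cong_right) (auto simp: S_def chsh_win_def)
  also have "\<dots> = 2 * p * (\<Sum>y\<in>UNIV. sum (pmf r) (S y)) / (2 * p * real CARD('a))"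
    using \<open>0 < p\<close> by simp
  also have "\<dots> \<le> (2 * p\<^sup>2 * real CARD('a) + 1) / (2 * p * real CARD('a))"
    using total \<open>0 < p\<close> by (intro divide_right_mono) auto
  also have "\<dots> = p + 1 / (2 * p * real CARD('a))"
    using \<open>0 < p\<close> by (simp add: field_simps power2_eq_square)
  finally show ?thesis .
qed

theorem mainTheorem2:
  fixes q :: nat and p :: real
  assumes "primepow q" and "CARD('a::{finite,field}) = q"
    and "0 < p" and "p \<le> 1" and "p > 1 / sqrt (2 * real q)"
  shows "chsh_value TYPE('a) p \<le> p + 1 / (2 * p * real q)"
proof -
  have q: "2 \<le> real q" using primepow_gt_Suc_0[OF assms(1)] by simp
  \<comment> \<open>The lower bound on \<open>p\<close> yields \<open>1 / q \<le> p\<close>, because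
    \<open>2 * q \<le> q\<^sup>2\<close> for \<open>q \<ge> 2\<close>. Hence the supremum is
    attained by some distribution and strategy, and the bound for a single strategy applies to
    it.\<close>
  hence "sqrt (2 * real q) \<le> real q"
    by (intro real_le_lsqrt) (auto simp: power2_eq_square)
  hence "1 / real q \<le> 1 / sqrt (2 * real q)" using q by (simp add: frac_le)
  with assms have "1 / real CARD('a) \<le> p" by simp
  from chsh_value_attained[OF this] show ?thesis
    using chsh_win_prob_le[OF _ \<open>0 < p\<close>] assms(2) by metis
qed

end
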